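(* Let $K$ be a field, $S=K[x_1,\dots,x_n]$, and let $I$ and $J$ be two monomial ideals of $S$ such that $I\subset J$, with radicals $\sqrt{I}$ and $\sqrt{J}$ respectively. Then $$\operatorname{sdepth}(J/I)\leq \operatorname{sdepth}(\sqrt{J}/\sqrt{I}).$$
   Context: Let $S=K[x_1,\dots,x_n]$ be a polynomial ring over a field $K$ with its standard $\mathbb{Z}^n$-grading, and let $M$ be a finitely generated $\mathbb{Z}^n$-graded $S$-module. For a homogeneous element $w\in M$ and a subset $Z\subset\{x_1,\dots,x_n\}$, $wK[Z]$ denotes the $K$-subspace of $M$ generated by all homogeneous elements $wv$ with $v$ a monomial in $K[Z]$. It is called a Stanley space of dimension $|Z|$ if it is a free $K[Z]$-module. A Stanley decomposition of $M$ is a presentation of the $K$-vector space $M$ as a finite direct sum of Stanley spaces $\mathcal{D}: M=\bigoplus_{i=1}^s u_iK[Z_i]$, and $\operatorname{sdepth}\mathcal{D}=\min\{|Z_i| : i=1,\dots,s\}$. The Stanley depth of $M$ is $\operatorname{sdepth}(M)=\max\{\operatorname{sdepth}\mathcal{D} : \mathcal{D}\text{ is a Stanley decomposition of } M\}$. *)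

theory Defs
  imports "HOL-Algebra.Algebraic_Closure_Type" "HOL-Library.Poly_Mapping"
    "HOL-Library.Extended_Nat"
begin

text \<open>
  A monomial is an exponent vector \<open>m\<close>, a polynomial is a finitely supported map from monomials to
  coefficients, with the ring operations of \<^theory>\<open>HOL-Library.Poly_Mapping\<close>. The variable
  \<open>x\<^sub>i\<close> is represented by its index \<open>i\<close>.
\<close>

type_synonym mono = "nat \<Rightarrow>\<^sub>0 nat"
type_synonym 'k mpoly = "mono \<Rightarrow>\<^sub>0 'k"

abbreviation monom_poly :: "mono \<Rightarrow> 'k::field mpoly" where
  "monom_poly m \<equiv> Poly_Mapping.single m 1"

abbreviation const_poly :: "'k::field \<Rightarrow> 'k mpoly" where
  "const_poly c \<equiv> Poly_Mapping.single 0 c"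

definition mpoly_ring :: "nat set \<Rightarrow> 'k::field mpoly ring" where
  "mpoly_ring Z = ring_of_type_algebra
     \<lparr>carrier := {f. \<forall>m \<in> Poly_Mapping.keys f. Poly_Mapping.keys m \<subseteq> Z}\<rparr>"

text \<open>The ring \<open>K[x\<^sub>1, \<dots>, x\<^sub>n]\<close>.\<close>

abbreviation S_ring :: "nat \<Rightarrow> 'k::field mpoly ring" where
  "S_ring n \<equiv> mpoly_ring {1..n}"

definition monomial_ideal :: "nat \<Rightarrow> 'k::field mpoly set \<Rightarrow> bool" where
  "monomial_ideal n I \<longleftrightarrow>
     (\<exists>A. (\<forall>m \<in> A. Poly_Mapping.keys m \<subseteq> {1..n}) \<and> I = Idl\<^bsub>S_ring n\<^esub> (monom_poly ` A))"

definition ideal_radical :: "('a, 'b) ring_scheme \<Rightarrow> 'a set \<Rightarrow> 'a set" where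
  "ideal_radical R I = {f \<in> carrier R. \<exists>k::nat. k > 0 \<and> f [^]\<^bsub>R\<^esub> k \<in> I}"

subsection \<open>Free modules and spans\<close>

definition is_basis :: "('a, 'r) ring_scheme \<Rightarrow> ('a, 'b, 'm) module_scheme \<Rightarrow> 'b set \<Rightarrow> bool" where
  "is_basis R N B \<longleftrightarrow> B \<subseteq> carrier N \<and>
     (\<forall>x \<in> carrier N. \<exists>A c. finite A \<and> A \<subseteq> B \<and> c \<in> A \<rightarrow> carrier R \<and>
        x = (\<Oplus>\<^bsub>N\<^esub>b \<in> A. c b \<odot>\<^bsub>N\<^esub> b)) \<and>
     (\<forall>A c. finite A \<longrightarrow> A \<subseteq> B \<longrightarrow> c \<in> A \<rightarrow> carrier R \<longrightarrow>
        (\<Oplus>\<^bsub>N\<^esub>b \<in> A. c b \<odot>\<^bsub>N\<^esub> b) = \<zero>\<^bsub>N\<^esub> \<longrightarrow> (\<forall>b \<in> A. c b = \<zero>\<^bsub>R\<^esub>))"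

definition free_module :: "('a, 'r) ring_scheme \<Rightarrow> ('a, 'b, 'm) module_scheme \<Rightarrow> bool" where
  "free_module R N \<longleftrightarrow> (\<exists>B. is_basis R N B)"

definition restrict_scalars :: "('k::field mpoly, 'b, 'm) module_scheme \<Rightarrow> ('k, 'b) module" where
  "restrict_scalars M =
     \<lparr>carrier = carrier M, monoid.mult = monoid.mult M, one = one M, zero = zero M, add = add M,
      Module.module.smult = (\<lambda>c x. const_poly c \<odot>\<^bsub>M\<^esub> x)\<rparr>"

definition K_span :: "('k::field mpoly, 'b, 'm) module_scheme \<Rightarrow> 'b set \<Rightarrow> 'b set" where
  "K_span M W =
     \<Inter>{V. submodule V (ring_of_type_algebra :: 'k ring) (restrict_scalars M) \<and> W \<subseteq> V}"

subsection \<open>Stanley depth\<close>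

text \<open>
  A \<open>\<int>\<^sup>n\<close>-graded module over \<open>K[x\<^sub>1, \<dots>, x\<^sub>n]\<close> carries its family of graded components. Degrees are
  functions on all of \<^typ>\<open>nat\<close>; \<open>\<int>\<^sup>n\<close> is the set of those vanishing outside \<open>{1..n}\<close>.
\<close>

record ('a, 'b) graded_module = "('a, 'b) module" +
  comp :: "(nat \<Rightarrow> int) \<Rightarrow> 'b set"

definition homogeneous :: "('a, 'b, 'm) graded_module_scheme \<Rightarrow> 'b \<Rightarrow> bool" where
  "homogeneous M w \<longleftrightarrow> (\<exists>a. w \<in> comp M a)"

text \<open>The \<open>K\<close>-subspace \<open>wK[Z]\<close>.\<close>

definition mono_space ::
    "('k::field mpoly, 'b, 'm) module_scheme \<Rightarrow> 'b \<Rightarrow> nat set \<Rightarrow> 'b set" where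
  "mono_space M w Z = K_span M {monom_poly v \<odot>\<^bsub>M\<^esub> w | v. Poly_Mapping.keys v \<subseteq> Z}"

definition stanley_space ::
    "nat \<Rightarrow> ('k::field mpoly, 'b, 'm) graded_module_scheme \<Rightarrow> 'b \<Rightarrow> nat set \<Rightarrow> bool" where
  "stanley_space n M w Z \<longleftrightarrow> homogeneous M w \<and> Z \<subseteq> {1..n} \<and>
     free_module (mpoly_ring Z :: 'k mpoly ring) (M\<lparr>carrier := mono_space M w Z\<rparr>)"

text \<open>The list of pairs \<open>(u\<^sub>i, Z\<^sub>i)\<close> stands for the family of the spaces \<open>u\<^sub>iK[Z\<^sub>i]\<close>.\<close>

definition stanley_decomposition ::
    "nat \<Rightarrow> ('k::field mpoly, 'b, 'm) graded_module_scheme \<Rightarrow> ('b \<times> nat set) list \<Rightarrow> bool" where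
  "stanley_decomposition n M D \<longleftrightarrow>
     (\<forall>(u, Z) \<in> set D. stanley_space n M u Z) \<and>
     (\<forall>x \<in> carrier M. \<exists>!f.
        f \<in> (\<Pi>\<^sub>E i \<in> {..<length D}. mono_space M (fst (D ! i)) (snd (D ! i))) \<and>
        x = (\<Oplus>\<^bsub>M\<^esub>i \<in> {..<length D}. f i))"

definition sdepth_decomp :: "('b \<times> nat set) list \<Rightarrow> enat" where
  "sdepth_decomp D = (INF (u, Z) \<in> set D. enat (card Z))"

text \<open>
  The values lie in \<^typ>\<open>enat\<close>, so that the minimum over the empty decomposition, which occurs for the
  zero module only, is \<open>\<infinity>\<close>: the zero module has Stanley depth \<open>\<infinity>\<close>. For a nonzero module all
  values are at most \<open>n\<close>, and the supremum is a maximum as soon as a decomposition exists.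
\<close>

definition sdepth :: "nat \<Rightarrow> ('k::field mpoly, 'b, 'm) graded_module_scheme \<Rightarrow> enat" where
  "sdepth n M = (SUP D \<in> {D. stanley_decomposition n M D}. sdepth_decomp D)"

subsection \<open>The module \<open>J/I\<close>\<close>

definition S_comp :: "nat \<Rightarrow> (nat \<Rightarrow> int) \<Rightarrow> 'k::field mpoly set" where
  "S_comp n a = {f \<in> carrier (S_ring n).
     \<forall>m \<in> Poly_Mapping.keys f. \<forall>i. int (Poly_Mapping.lookup m i) = a i}"

text \<open>
  \<open>J/I\<close> is the submodule of \<open>S/I\<close> formed by the cosets of elements of \<open>J\<close>; its component of degree
  \<open>a\<close> is the image of \<open>J \<inter> S\<^sub>a\<close>. The fields \<open>mult\<close> and \<open>one\<close> are part of the record type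
  only and play no role for modules.
\<close>

definition quot_module ::
    "nat \<Rightarrow> 'k::field mpoly set \<Rightarrow> 'k mpoly set \<Rightarrow> ('k mpoly, 'k mpoly set) graded_module" where
  "quot_module n J I = (let S = S_ring n; Q = S Quot I in
     \<lparr>carrier = (\<lambda>f. I +>\<^bsub>S\<^esub> f) ` J, monoid.mult = monoid.mult Q, one = one Q,
      zero = zero Q, add = add Q,
      Module.module.smult = (\<lambda>s C. (I +>\<^bsub>S\<^esub> s) \<otimes>\<^bsub>Q\<^esub> C),
      comp = (\<lambda>a. (\<lambda>f. I +>\<^bsub>S\<^esub> f) ` (J \<inter> S_comp n a))\<rparr>)"

end

theory Submission
  imports Defs
begin

text \<open>
  For a monomial ideal \<open>I\<close> and all large \<open>a\<close>, a monomial \<open>w\<close> lies in \<open>\<surd>I\<close> iff \<open>w\<^sup>a\<close> lies in \<open>I\<close>. A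
  Stanley decomposition of \<open>J/I\<close> partitions the monomials of \<open>J - I\<close> into boxes \<open>uK[Z]\<close>, and pulling
  this partition back along \<open>w \<mapsto> w\<^sup>a\<close> partitions the monomials of \<open>\<surd>J - \<surd>I\<close>: the preimage of
  \<open>uK[Z]\<close> is either empty or again a box \<open>u'K[Z]\<close> with the same \<open>Z\<close>.
\<close>

text \<open>The depth of a decomposition sees only which sets Z occur in it, so it suffices to find,
  for each decomposition of J/I, one of sqrt(J)/sqrt(I) whose sets Z all occur in the given one.
  Boxes lost in the pullback can only raise the minimum. Membership in a box is a condition on each
  coordinate separately, a lower bound or an equation, and both kinds survive multiplication of the
  coordinate by a. A single a has to serve all monomials and both ideals at once. The obstacle is
  that a Stanley decomposition speaks of vector spaces of cosets, while the pullback lives on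
  monomials, so a translation is needed in both directions. It rests on three facts: a homogeneous
  element for the fine grading is a scalar times a monomial; the coefficient of a monomial outside I
  depends only on the coset; and freeness over K[Z] is exactly what keeps the box of a nonzero
  generator away from I.\<close>

declare One_nat_def [simp del]

abbreviation keys where "keys \<equiv> Poly_Mapping.keys"
abbreviation lookup where "lookup \<equiv> Poly_Mapping.lookup"
abbreviation single where "single \<equiv> Poly_Mapping.single"

section \<open>Monomials and polynomials supported on a set of monomials\<close>

definition monoms :: "nat set \<Rightarrow> mono set" where
  "monoms Z = {m. keys m \<subseteq> Z}"

text \<open>The K-span of the monomials in \<open>T\<close>. This one notion covers K[Z]
  (\<open>T = monoms Z\<close>), monomial ideals (\<open>T\<close> closed under multiples) and
  lifted Stanley spaces (\<open>T\<close> a box).\<close>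

definition polys :: "mono set \<Rightarrow> 'k::field mpoly set" where
  "polys T = {f. keys f \<subseteq> T}"

definition mono_ideal :: "nat \<Rightarrow> mono set \<Rightarrow> bool" where
  "mono_ideal n P \<longleftrightarrow> P \<subseteq> monoms {1..n} \<and> (\<forall>p \<in> P. \<forall>v \<in> monoms {1..n}. p + v \<in> P)"

text \<open>Exponents are written additively, so this is the exponent vector of the power
  m^a.\<close>

definition mscale :: "nat \<Rightarrow> mono \<Rightarrow> mono" where
  "mscale a m = Poly_Mapping.map ((*) a) m"

definition restrict_poly :: "'k::field mpoly \<Rightarrow> mono set \<Rightarrow> 'k mpoly" where
  "restrict_poly f T = (\<Sum>m \<in> keys f \<inter> T. single m (lookup f m))"

lemma monoms_mono: "Z \<subseteq> Z' \<Longrightarrow> monoms Z \<subseteq> monoms Z'"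
  by (auto simp: monoms_def)

lemma keys_add_mono: "keys (m + v) = keys m \<union> keys (v :: mono)"
  by (auto simp: in_keys_iff lookup_add)

lemma monoms_0 [simp]: "0 \<in> monoms Z"
  by (simp add: monoms_def)

lemma monoms_add: "m \<in> monoms Z \<Longrightarrow> v \<in> monoms Z \<Longrightarrow> m + v \<in> monoms Z"
  by (simp add: monoms_def keys_add_mono)

lemma lookup_mscale [simp]: "lookup (mscale a m) i = a * lookup m i"
  by (simp add: mscale_def Poly_Mapping.map.rep_eq when_def)

lemma mscale_monoms: "m \<in> monoms Z \<Longrightarrow> mscale a m \<in> monoms Z"
  by (auto simp: monoms_def in_keys_iff subset_iff)

lemma mscale_add: "mscale (a + b) m = mscale a m + mscale b m"
  by (rule poly_mapping_eqI) (simp add: lookup_add algebra_simps)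

lemma mscale_Suc: "mscale (Suc a) m = m + mscale a m"
  by (rule poly_mapping_eqI) (simp add: lookup_add)

lemma mscale_0 [simp]: "mscale 0 m = 0"
  by (rule poly_mapping_eqI) simp

lemma polys_mono: "T \<subseteq> Y \<Longrightarrow> polys T \<subseteq> polys Y"
  by (auto simp: polys_def)

lemma polys_0 [simp]: "0 \<in> polys T"
  by (simp add: polys_def)

lemma polys_add: "f \<in> polys T \<Longrightarrow> g \<in> polys T \<Longrightarrow> f + g \<in> polys T"
  using Poly_Mapping.keys_add[of f g] by (auto simp: polys_def)

lemma keys_uminus [simp]: "keys (- f) = keys (f :: 'k::field mpoly)"
  by (auto simp: in_keys_iff)

lemma polys_uminus: "f \<in> polys T \<Longrightarrow> - f \<in> polys T"
  by (simp add: polys_def)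

lemma polys_diff: "f \<in> polys T \<Longrightarrow> g \<in> polys T \<Longrightarrow> f - g \<in> polys T"
  using polys_add[of f T "- g"] by (simp add: polys_uminus)

lemma polys_sum: "(\<And>i. i \<in> A \<Longrightarrow> f i \<in> polys T) \<Longrightarrow> sum f A \<in> polys T"
  by (induction A rule: infinite_finite_induct) (auto intro: polys_add)

lemma polys_single: "m \<in> T \<Longrightarrow> single m c \<in> polys T"
  by (simp add: polys_def)

lemma polys_single_iff: "single m c \<in> polys T \<longleftrightarrow> c = 0 \<or> m \<in> T"
  by (simp add: polys_def)

lemma polys_mult:
  assumes "f \<in> polys T" "g \<in> polys Y" "\<And>x y. x \<in> T \<Longrightarrow> y \<in> Y \<Longrightarrow> x + y \<in> W"
  shows "f * g \<in> polys W"
  using assms keys_mult[of f g] unfolding polys_def by blast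

lemma poly_eq_sum: "(f :: 'k::field mpoly) = (\<Sum>m \<in> keys f. single m (lookup f m))"
proof (rule poly_mapping_eqI)
  fix k
  have "(\<Sum>m \<in> keys f. lookup (single m (lookup f m)) k)
      = (\<Sum>m \<in> keys f. if m = k then lookup f m else 0)"
    by (rule sum.cong) (auto simp: lookup_single when_def)
  then show "lookup f k = lookup (\<Sum>m \<in> keys f. single m (lookup f m)) k"
    by (simp add: lookup_sum in_keys_iff)
qed

lemma lookup_restrict_poly [simp]:
  "lookup (restrict_poly f T) k = (if k \<in> T then lookup f k else 0)"
proof -
  have "(\<Sum>m \<in> keys f \<inter> T. lookup (single m (lookup f m)) k)
      = (\<Sum>m \<in> keys f \<inter> T. if m = k then lookup f m else 0)"
    by (rule sum.cong) (auto simp: lookup_single when_def)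
  then show ?thesis
    by (simp add: restrict_poly_def lookup_sum in_keys_iff)
qed

lemma restrict_poly_polys: "restrict_poly f T \<in> polys T"
  by (auto simp: polys_def in_keys_iff split: if_splits)

lemma polys_induct [consumes 1, case_names zero add single]:
  assumes "f \<in> polys T" and "R 0"
    and "\<And>f g. f \<in> polys T \<Longrightarrow> g \<in> polys T \<Longrightarrow> R f \<Longrightarrow> R g \<Longrightarrow> R (f + g)"
    and "\<And>m c. m \<in> T \<Longrightarrow> R (single m c)"
  shows "R f"
proof -
  have "finite A \<Longrightarrow> A \<subseteq> T \<Longrightarrow> R (\<Sum>m \<in> A. single m (lookup f m))" for A
  proof (induction A rule: finite_induct)
    case (insert m A)
    then show ?case
      using assms(3)[of "single m (lookup f m)" "\<Sum>m \<in> A. single m (lookup f m)"] assms(4)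
      by (auto intro!: polys_sum polys_single)
  qed (simp add: assms(2))
  from this[of "keys f"] assms(1) show ?thesis
    using poly_eq_sum[of f] by (simp add: polys_def)
qed

text \<open>Shifting exponents by \<open>v\<close> is injective, so only the term of
  \<open>f\<close> at \<open>q\<close> contributes and nothing can cancel.\<close>

lemma lookup_mult_monom:
  "lookup ((f :: 'k::field mpoly) * single v c) (q + v) = lookup f q * c"
proof -
  have "f * single v c = (\<Sum>m \<in> keys f. single (m + v) (lookup f m * c))"
    by (subst poly_eq_sum[of f]) (simp add: sum_distrib_right mult_single)
  then have "lookup (f * single v c) (q + v)
      = (\<Sum>m \<in> keys f. if m = q then lookup f m * c else 0)"
    by (auto simp: lookup_sum lookup_single when_def intro!: sum.cong)
  then show ?thesis
    by (auto simp: in_keys_iff)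
qed

section \<open>Monomial ideals and their radicals\<close>

lemma mono_ideal_add: "mono_ideal n P \<Longrightarrow> p \<in> P \<Longrightarrow> v \<in> monoms {1..n} \<Longrightarrow> p + v \<in> P"
  by (simp add: mono_ideal_def)

lemma mono_ideal_monoms: "mono_ideal n P \<Longrightarrow> P \<subseteq> monoms {1..n}"
  by (simp add: mono_ideal_def)

section \<open>Polynomial rings and monomial ideals as spans of monomials\<close>

lemma mpoly_ring_simps [simp]:
  "carrier (mpoly_ring Z) = polys (monoms Z)"
  "x \<otimes>\<^bsub>mpoly_ring Z\<^esub> y = x * y" "x \<oplus>\<^bsub>mpoly_ring Z\<^esub> y = x + y"
  "\<zero>\<^bsub>mpoly_ring Z\<^esub> = 0" "\<one>\<^bsub>mpoly_ring Z\<^esub> = 1"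
  by (auto simp: mpoly_ring_def ring_of_type_algebra_def polys_def monoms_def)

lemma polys_monoms_mult:
  "f \<in> polys (monoms Z) \<Longrightarrow> g \<in> polys (monoms Z) \<Longrightarrow> f * g \<in> polys (monoms Z)"
  by (erule (1) polys_mult) (rule monoms_add)

lemma polys_monoms_1: "1 \<in> polys (monoms Z)"
  using polys_single[of 0 "monoms Z" 1] by simp

lemma polys_ideal_mult:
  "mono_ideal n P \<Longrightarrow> f \<in> polys P \<Longrightarrow> g \<in> polys (monoms {1..n}) \<Longrightarrow> f * g \<in> polys P"
  by (erule (1) polys_mult) (rule mono_ideal_add)

lemma polys_monoms_power: "f \<in> polys (monoms Z) \<Longrightarrow> f ^ k \<in> polys (monoms Z)"
  by (induction k) (auto intro: polys_monoms_1 polys_monoms_mult)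

lemma cring_mpoly_ring: "cring (mpoly_ring Z :: 'k::field mpoly ring)"
proof (rule cringI)
  show "abelian_group (mpoly_ring Z :: 'k mpoly ring)"
  proof (rule abelian_groupI)
    fix x :: "'k mpoly" assume "x \<in> carrier (mpoly_ring Z)"
    then show "\<exists>y \<in> carrier (mpoly_ring Z). y \<oplus>\<^bsub>mpoly_ring Z\<^esub> x = \<zero>\<^bsub>mpoly_ring Z\<^esub>"
      by (intro bexI[of _ "- x"]) (auto intro: polys_uminus)
  qed (auto intro: polys_add simp: algebra_simps)
  show "comm_monoid (mpoly_ring Z :: 'k mpoly ring)"
    by (rule comm_monoidI) (auto intro: polys_monoms_mult polys_monoms_1 simp: algebra_simps)
qed (simp add: algebra_simps)

lemma mpoly_ring_pow: "f [^]\<^bsub>mpoly_ring Z\<^esub> (k::nat) = (f :: 'k::field mpoly) ^ k"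
proof -
  interpret cring "mpoly_ring Z :: 'k mpoly ring" by (rule cring_mpoly_ring)
  show ?thesis by (induction k) (simp_all add: mult.commute)
qed

lemma ideal_polys:
  assumes "mono_ideal n P"
  shows "ideal (polys P) (S_ring n :: 'k::field mpoly ring)"
proof -
  interpret cring "S_ring n :: 'k mpoly ring" by (rule cring_mpoly_ring)
  have PS: "(polys P :: 'k mpoly set) \<subseteq> polys (monoms {1..n})"
    by (intro polys_mono mono_ideal_monoms assms)
  have sub: "subgroup (polys P :: 'k mpoly set) (add_monoid (S_ring n))"
  proof (rule add.subgroupI)
    fix f :: "'k mpoly" assume f: "f \<in> polys P"
    have "\<ominus>\<^bsub>S_ring n\<^esub> f = - f"
      by (rule minus_equality) (use f PS in \<open>auto intro: polys_uminus\<close>)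
    then show "\<ominus>\<^bsub>S_ring n\<^esub> f \<in> polys P" using f by (simp add: polys_uminus)
  qed (use PS polys_0[of P] in \<open>auto intro: polys_add simp del: polys_0\<close>)
  show ?thesis
    by (rule idealI[OF _ sub])
       (auto intro: polys_ideal_mult[OF assms] simp: mult.commute ring_axioms)
qed

text \<open>Take for \<open>P\<close> all monomial multiples of the generators. Its span is an ideal
  containing the generators, hence contains \<open>I\<close>; conversely each term with exponent in
  \<open>P\<close> is a multiple of a generator, hence lies in \<open>I\<close>.\<close>

lemma monomial_ideal_eq_polys:
  assumes "monomial_ideal n (I :: 'k::field mpoly set)"
  obtains P where "mono_ideal n P" "I = polys P"
proof -
  obtain A where A: "\<forall>m \<in> A. keys m \<subseteq> {1..n}"
    and I: "I = Idl\<^bsub>S_ring n\<^esub> (monom_poly ` A)"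
    using assms by (auto simp: monomial_ideal_def)
  interpret cring "S_ring n :: 'k mpoly ring" by (rule cring_mpoly_ring)
  have sub: "monom_poly ` A \<subseteq> carrier (S_ring n :: 'k mpoly ring)"
    using A by (auto intro!: polys_single simp: monoms_def)
  define P where "P = {a + v | a v. a \<in> A \<and> v \<in> monoms {1..n}}"
  have P: "mono_ideal n P"
    using A monoms_add unfolding mono_ideal_def P_def
    by (fastforce simp: add.assoc monoms_def keys_add_mono)
  have AP: "A \<subseteq> P"
    unfolding P_def by auto (metis add.right_neutral monoms_0)
  interpret I: ideal I "S_ring n :: 'k mpoly ring"
    unfolding I by (rule genideal_ideal[OF sub])
  have "I \<subseteq> polys P"
    unfolding I
    by (rule genideal_minimal[OF ideal_polys[OF P]]) (use AP in \<open>auto intro: polys_single\<close>)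
  moreover have "f \<in> I" if "f \<in> polys P" for f
    using that
  proof (induction rule: polys_induct)
    case zero
    show ?case using I.zero_closed by simp
  next
    case (add f g)
    then show ?case using I.a_closed by simp
  next
    case (single m c)
    then obtain a v where m: "m = a + v" and a: "a \<in> A" and v: "v \<in> monoms {1..n}"
      by (auto simp: P_def)
    have "monom_poly a \<in> I"
      unfolding I using genideal_self[OF sub] a by auto
    then have "single v c \<otimes>\<^bsub>S_ring n\<^esub> monom_poly a \<in> I"
      by (rule I.I_l_closed) (simp add: polys_single v)
    then show ?case by (simp add: mult_single m add.commute)
  qed
  ultimately show ?thesis using that P by blast
qed

section \<open>Radicals of monomial ideals and a uniform exponent\<close>

definition mono_radical :: "mono set \<Rightarrow> mono set" where
  "mono_radical P = {m. \<exists>k > 0. mscale k m \<in> P}"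

lemma single_power: "single m c ^ k = single (mscale k m) ((c :: 'k::field) ^ k)"
  by (induction k) (simp_all add: mult_single mscale_Suc)

lemma mscale_ideal_le:
  assumes "mono_ideal n P" "mscale k m \<in> P" "m \<in> monoms {1..n}" "k \<le> l"
  shows "mscale l m \<in> P"
proof -
  have "mscale l m = mscale k m + mscale (l - k) m"
    using assms(4) by (simp flip: mscale_add)
  then show ?thesis
    using assms by (auto intro: mono_ideal_add mscale_monoms)
qed

lemma mono_radical_monoms:
  assumes "mono_ideal n P"
  shows "mono_radical P \<subseteq> monoms {1..n}"
proof
  fix m assume "m \<in> mono_radical P"
  then obtain k where k: "k > 0" "mscale k m \<in> P" by (auto simp: mono_radical_def)
  then have "keys (mscale k m) \<subseteq> {1..n}"
    using mono_ideal_monoms[OF assms] by (auto simp: monoms_def)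
  then show "m \<in> monoms {1..n}"
    using k(1) by (auto simp: monoms_def in_keys_iff subset_iff)
qed

lemma mono_ideal_radical:
  assumes "mono_ideal n P"
  shows "mono_ideal n (mono_radical P)"
proof -
  have "p + v \<in> mono_radical P" if p: "p \<in> mono_radical P" and v: "v \<in> monoms {1..n}" for p v
  proof -
    obtain k where k: "k > 0" "mscale k p \<in> P"
      using p by (auto simp: mono_radical_def)
    have "mscale k (p + v) = mscale k p + mscale k v"
      by (rule poly_mapping_eqI) (simp add: lookup_add algebra_simps)
    then show ?thesis
      using k v mono_ideal_add[OF assms] mscale_monoms by (auto simp: mono_radical_def)
  qed
  then show ?thesis
    using mono_radical_monoms[OF assms] by (auto simp: mono_ideal_def)
qed

text \<open>Exponents carry a linear order compatible with addition. A product of terms reaches the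
  top exponent only if every factor is the leading term, so the leading coefficient of a power is
  the power of the leading coefficient.\<close>

lemma lookup_power_Max:
  assumes m: "\<And>q. q \<in> keys f \<Longrightarrow> q \<le> m"
  shows "lookup ((f :: 'k::field mpoly) ^ k) (mscale k m) = lookup f m ^ k
    \<and> (\<forall>q \<in> keys (f ^ k). q \<le> mscale k m)"
proof (induction k)
  case 0
  then show ?case by simp
next
  case (Suc k)
  have bound: "q \<le> mscale (Suc k) m" if "q \<in> keys (f ^ Suc k)" for q
    using that keys_mult[of f "f ^ k"] Suc m by (auto simp: mscale_Suc intro: add_mono)
  define g where "g = f - single m (lookup f m)"
  have g: "q < m" if "q \<in> keys g" for q
    using that m[of q] unfolding g_def
    by (cases "q = m") (auto simp: in_keys_iff lookup_minus lookup_single when_def)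
  have "mscale (Suc k) m \<notin> keys (g * f ^ k)"
  proof
    assume "mscale (Suc k) m \<in> keys (g * f ^ k)"
    then obtain a b where "m + mscale k m = a + b" "a < m" "b \<le> mscale k m"
      using keys_mult[of g "f ^ k"] Suc g by (fastforce simp: mscale_Suc)
    then show False using add_less_le_mono[of a m b "mscale k m"] by simp
  qed
  moreover have "f ^ Suc k = g * f ^ k + f ^ k * single m (lookup f m)"
    by (simp add: g_def algebra_simps)
  ultimately have "lookup (f ^ Suc k) (mscale (Suc k) m)
      = lookup (f ^ k * single m (lookup f m)) (mscale k m + m)"
    by (simp add: lookup_add in_keys_iff mscale_Suc add.commute)
  then show ?case
    using bound Suc by (simp add: lookup_mult_monom)
qed

text \<open>The point is that the radical is spanned by its monomials. If f^k lies in
  \<open>polys P\<close>, then so does its leading monomial, hence the leading monomial of f is in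
  \<open>mono_radical P\<close>. Subtracting the leading term therefore stays inside the radical and
  leaves fewer terms.\<close>

lemma radical_polys:
  assumes P: "mono_ideal n P"
  shows "ideal_radical (S_ring n) (polys P) = (polys (mono_radical P) :: 'k::field mpoly set)"
proof -
  define R :: "'k mpoly set" where
    "R = {f \<in> polys (monoms {1..n}). \<exists>k > 0. f ^ k \<in> polys P}"
  have R_single: "single m c \<in> R" if m: "m \<in> mono_radical P" for m c
  proof -
    obtain k where "k > 0" "mscale k m \<in> P" using m by (auto simp: mono_radical_def)
    then show ?thesis
      using m mono_radical_monoms[OF P]
      by (auto simp: R_def single_power intro!: polys_single exI[of _ k])
  qed
  have R_add: "f + g \<in> R" if fg: "f \<in> R" "g \<in> R" for f g
  proof -
    obtain a b where ab: "a > 0" "f ^ a \<in> polys P" "b > 0" "g ^ b \<in> polys P"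
      and S: "f \<in> polys (monoms {1..n})" "g \<in> polys (monoms {1..n})"
      using fg by (auto simp: R_def)
    \<comment> \<open>Each binomial term is divisible by f^a (if \<open>a \<le> i\<close>) or by g^b
      (otherwise, since then a + b - i exceeds b).\<close>
    have "of_nat ((a + b) choose i) * f ^ i * g ^ (a + b - i) \<in> polys P" for i
    proof -
      have c: "of_nat ((a + b) choose i) \<in> (polys (monoms {1..n}) :: 'k mpoly set)"
        by (metis polys_single monoms_0 single_of_nat)
      show ?thesis
      proof (cases "a \<le> i")
        case True
        have e: "of_nat ((a + b) choose i) * f ^ i * g ^ (a + b - i)
            = f ^ a * (of_nat ((a + b) choose i) * (f ^ (i - a) * g ^ (a + b - i)))"
          using power_add[of f a "i - a"] True by (simp add: mult_ac)
        show ?thesis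
          using ab(2) S c unfolding e
          by (intro polys_ideal_mult[OF P] polys_monoms_mult polys_monoms_power)
      next
        case False
        have e: "of_nat ((a + b) choose i) * f ^ i * g ^ (a + b - i)
            = g ^ b * (of_nat ((a + b) choose i) * (f ^ i * g ^ (a - i)))"
        proof -
          have "a + b - i = b + (a - i)" using False by simp
          then show ?thesis by (simp only: power_add mult_ac)
        qed
        show ?thesis
          using ab(4) S c unfolding e
          by (intro polys_ideal_mult[OF P] polys_monoms_mult polys_monoms_power)
      qed
    qed
    then have "(f + g) ^ (a + b) \<in> polys P"
      unfolding binomial_ring by (intro polys_sum)
    then show ?thesis
      using ab S by (auto simp: R_def intro!: polys_add exI[of _ "a + b"])
  qed
  have "f \<in> polys (mono_radical P)" if "f \<in> R" for f
    using that
  proof (induction "card (keys f)" arbitrary: f rule: less_induct)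
    case less
    show ?case
    proof (cases "f = 0")
      case False
      define m where "m = Max (keys f)"
      have mk: "m \<in> keys f" unfolding m_def using False by (intro Max_in) auto
      have le: "q \<in> keys f \<Longrightarrow> q \<le> m" for q unfolding m_def by simp
      obtain k where k: "k > 0" "f ^ k \<in> polys P" using less.prems by (auto simp: R_def)
      have "mscale k m \<in> keys (f ^ k)"
        using lookup_power_Max[of f m k] le mk by (simp add: in_keys_iff)
      then have m: "m \<in> mono_radical P"
        using k by (auto simp: polys_def mono_radical_def)
      define g where "g = f + single m (- lookup f m)"
      have lg: "lookup g q = (if q = m then 0 else lookup f q)" for q
        by (simp add: g_def lookup_add lookup_single when_def)
      have "keys g \<subseteq> keys f" "m \<notin> keys g"
        by (auto simp: in_keys_iff lg split: if_splits)
      then have "keys g \<subset> keys f" using mk by blast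
      then have "card (keys g) < card (keys f)" by (intro psubset_card_mono) auto
      moreover have "g \<in> R"
        unfolding g_def by (intro R_add R_single m less.prems)
      ultimately have "g \<in> polys (mono_radical P)" by (rule less.hyps)
      then have "g + single m (lookup f m) \<in> polys (mono_radical P)"
        by (intro polys_add polys_single m)
      moreover have "g + single m (lookup f m) = f"
        by (rule poly_mapping_eqI) (simp add: lookup_add lg lookup_single when_def)
      ultimately show ?thesis by simp
    qed simp
  qed
  moreover have "f \<in> R" if "f \<in> polys (mono_radical P)" for f
    using that
  proof (induction rule: polys_induct)
    case zero
    show ?case by (auto simp: R_def zero_power intro!: exI[of _ 1])
  qed (auto intro: R_add R_single)
  moreover have "ideal_radical (S_ring n) (polys P) = R"
    unfolding ideal_radical_def R_def mpoly_ring_pow mpoly_ring_simps ..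
  ultimately show ?thesis by blast
qed

text \<open>Membership in the radical only depends on the support of the exponent vector, and there are
  finitely many supports; hence the exponent can be chosen uniformly.\<close>

lemma uniform_radical_exponent:
  assumes P: "mono_ideal n P"
  shows "\<exists>a0 > 0. \<forall>a \<ge> a0. \<forall>m. mscale a m \<in> P \<longleftrightarrow> m \<in> mono_radical P"
proof -
  have "\<exists>b. \<forall>m. m \<in> mono_radical P \<and> keys m = F \<longrightarrow> mscale b m \<in> P" for F
  proof (cases "\<exists>m0. m0 \<in> mono_radical P \<and> keys m0 = F")
    case True
    then obtain m0 where m0: "m0 \<in> mono_radical P" "keys m0 = F" by blast
    then obtain k where k: "mscale k m0 \<in> P" by (auto simp: mono_radical_def)
    \<comment> \<open>On \<open>F\<close> the coordinates of \<open>m\<close> are at least 1 and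
      those of \<open>m0\<close> at most their sum, so m^b is a multiple of m0^k for every
      \<open>m\<close> with the same support.\<close>
    define b where "b = k * (\<Sum>i \<in> F. lookup m0 i)"
    have "mscale b m \<in> P" if m: "m \<in> mono_radical P" "keys m = F" for m
    proof -
      have le: "k * lookup m0 i \<le> b * lookup m i" for i
      proof (cases "i \<in> F")
        case True
        have "lookup m0 i \<le> (\<Sum>i \<in> F. lookup m0 i)"
          using True m0 by (intro member_le_sum) auto
        moreover have "1 \<le> lookup m i" using True m by (auto simp: in_keys_iff Suc_le_eq)
        ultimately have "lookup m0 i * 1 \<le> (\<Sum>i \<in> F. lookup m0 i) * lookup m i"
          by (rule mult_le_mono)
        then show ?thesis by (simp add: b_def)
      next
        case False
        then show ?thesis using m0 by (auto simp: in_keys_iff)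
      qed
      \<comment> \<open>Subtraction of exponents truncates at 0; \<open>le\<close> makes it the
        exact complement.\<close>
      have eq: "mscale b m = mscale k m0 + (mscale b m - mscale k m0)"
        by (rule poly_mapping_eqI) (simp add: lookup_add lookup_minus le)
      have "mscale b m \<in> monoms {1..n}"
        using m mono_radical_monoms[OF P] by (intro mscale_monoms) auto
      then have "mscale b m - mscale k m0 \<in> monoms {1..n}"
        using keys_add_mono eq by (metis (mono_tags) le_sup_iff mem_Collect_eq monoms_def)
      then show ?thesis
        by (subst eq) (intro mono_ideal_add[OF P] k)
    qed
    then show ?thesis by blast
  qed blast
  then obtain b where b: "\<And>F m. m \<in> mono_radical P \<Longrightarrow> keys m = F \<Longrightarrow> mscale (b F) m \<in> P"
    by metis
  \<comment> \<open>The sum over all supports is a common upper bound for the exponents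
    \<open>b F\<close>, and membership persists for larger exponents.\<close>
  have "mscale a m \<in> P"
    if a: "(\<Sum>F \<in> Pow {1..n}. b F) \<le> a" and m: "m \<in> mono_radical P" for a m
  proof -
    have mm: "m \<in> monoms {1..n}" using m mono_radical_monoms[OF P] by auto
    then have "b (keys m) \<le> (\<Sum>F \<in> Pow {1..n}. b F)"
      by (intro member_le_sum) (auto simp: monoms_def)
    then show ?thesis
      using mscale_ideal_le[OF P b[OF m refl] mm] a by simp
  qed
  moreover have "m \<in> mono_radical P" if "Suc k \<le> a" "mscale a m \<in> P" for a k m
    using that unfolding mono_radical_def by (intro CollectI exI[of _ a]) simp
  \<comment> \<open>\<open>Suc\<close> keeps the exponent positive: m^0 = 1 says nothing about
    \<open>m\<close>, so the direction back to the radical would fail at 0.\<close>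
  ultimately show ?thesis
    by (intro exI[of _ "Suc (\<Sum>F \<in> Pow {1..n}. b F)"])
       (meson Suc_leD zero_less_Suc)
qed

section \<open>Partitions into boxes\<close>

definition box :: "mono \<Rightarrow> nat set \<Rightarrow> mono set" where
  "box m Z = (+) m ` monoms Z"

text \<open>The combinatorial form of a Stanley decomposition, with \<open>T\<close> the set of
  monomials in J but not in I. The unique existence expresses covering and disjointness
  together.\<close>

definition box_partition :: "nat \<Rightarrow> mono set \<Rightarrow> (mono \<times> nat set) set \<Rightarrow> bool" where
  "box_partition n T E \<longleftrightarrow> finite E \<and> (\<forall>(m, Z) \<in> E. Z \<subseteq> {1..n} \<and> box m Z \<subseteq> T) \<and>
     (\<forall>q \<in> T. \<exists>!e. e \<in> E \<and> q \<in> box (fst e) (snd e))"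

text \<open>Turns membership into independent conditions on the coordinates, a lower bound in the
  directions of \<open>Z\<close> and an equation in the others; this is what lets the pullback be
  computed coordinate by coordinate.\<close>

lemma mem_box_iff:
  "q \<in> box m Z \<longleftrightarrow> (\<forall>i. lookup m i \<le> lookup q i \<and> (i \<notin> Z \<longrightarrow> lookup q i = lookup m i))"
proof
  assume "q \<in> box m Z"
  then show "\<forall>i. lookup m i \<le> lookup q i \<and> (i \<notin> Z \<longrightarrow> lookup q i = lookup m i)"
    by (auto simp: box_def monoms_def lookup_add in_keys_iff)
next
  assume *: "\<forall>i. lookup m i \<le> lookup q i \<and> (i \<notin> Z \<longrightarrow> lookup q i = lookup m i)"
  have "q = m + (q - m)"
    by (rule poly_mapping_eqI) (simp add: * lookup_add lookup_minus)
  moreover have "q - m \<in> monoms Z"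
    using * by (force simp: monoms_def in_keys_iff lookup_minus)
  ultimately show "q \<in> box m Z" by (auto simp: box_def)
qed

lemma self_mem_box [simp]: "m \<in> box m Z"
  by (simp add: mem_box_iff)

text \<open>The corner of the preimage is \<open>m\<close> divided by \<open>a\<close> and rounded up.\<close>

lemma box_pullback:
  assumes a: "a > 0"
  shows "(\<forall>q. mscale a q \<notin> box m Z) \<or> (\<exists>m'. \<forall>q. mscale a q \<in> box m Z \<longleftrightarrow> q \<in> box m' Z)"
proof (cases "\<forall>i. i \<notin> Z \<longrightarrow> a dvd lookup m i")
  \<comment> \<open>Outside \<open>Z\<close> the condition on q reads a * q_i = m_i, which is
    solvable exactly when a divides m_i. If this fails for some such i, the preimage is
    empty.\<close>
  case True
  define m' where "m' = Poly_Mapping.map (\<lambda>c. (c + (a - 1)) div a) m"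
  have m': "lookup m' i = (lookup m i + (a - 1)) div a" for i
    using a by (simp add: m'_def Poly_Mapping.map.rep_eq when_def)
  \<comment> \<open>Rounding up is adjoint to multiplication by \<open>a\<close>; this settles the
    lower bounds, and where \<open>a\<close> divides the coordinate it yields the equations as
    well.\<close>
  have le: "lookup m i \<le> a * c \<longleftrightarrow> lookup m' i \<le> c" for i c
  proof -
    have "lookup m' i \<le> c \<longleftrightarrow> (lookup m i + (a - 1)) div a < Suc c" by (simp add: m' less_Suc_eq_le)
    also have "\<dots> \<longleftrightarrow> lookup m i + (a - 1) < Suc c * a" using a by (simp add: div_less_iff_less_mult)
    also have "\<dots> \<longleftrightarrow> lookup m i \<le> a * c" using a by (auto simp: algebra_simps)
    finally show ?thesis ..
  qed
  have eq: "a * c = lookup m i \<longleftrightarrow> c = lookup m' i" if i: "i \<notin> Z" for i c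
  proof -
    obtain d where d: "lookup m i = a * d" using True i by (auto elim: dvdE)
    have "lookup m' i = d"
      using le[of i] d a by (metis dual_order.eq_iff mult_le_cancel1)
    then show ?thesis using d a by simp
  qed
  have "mscale a q \<in> box m Z \<longleftrightarrow> q \<in> box m' Z" for q
    unfolding mem_box_iff by (simp add: le eq cong: imp_cong)
  then show ?thesis by blast
next
  case False
  then show ?thesis
    by (auto simp: mem_box_iff) (metis dvd_triv_left)
qed

lemma box_partition_radical:
  assumes P: "mono_ideal n P" and Q: "mono_ideal n Q" and E: "box_partition n (Q - P) E"
  shows "\<exists>E'. box_partition n (mono_radical Q - mono_radical P) E' \<and> snd ` E' \<subseteq> snd ` E"
proof -
  obtain a0 b0 where a0: "a0 > 0" "\<And>a m. a \<ge> a0 \<Longrightarrow> mscale a m \<in> P \<longleftrightarrow> m \<in> mono_radical P"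
    and b0: "\<And>a m. a \<ge> b0 \<Longrightarrow> mscale a m \<in> Q \<longleftrightarrow> m \<in> mono_radical Q"
    using uniform_radical_exponent[OF P] uniform_radical_exponent[OF Q] by metis
  \<comment> \<open>At least \<open>a0\<close> and at least \<open>b0\<close>, so that one exponent
    works for both ideals.\<close>
  define a where "a = a0 + b0"
  have a: "a > 0" using a0(1) by (simp add: a_def)
  have rad: "q \<in> mono_radical Q - mono_radical P \<longleftrightarrow> mscale a q \<in> Q - P" for q
    using a0(2)[of a q] b0[of a q] by (simp add: a_def)
  \<comment> \<open>Boxes with empty preimage have no corner to pull back and are dropped; this is
    why the sets \<open>Z\<close> of the new partition only form a subset of the old ones.\<close>
  define hit where "hit e \<longleftrightarrow> (\<exists>q. mscale a q \<in> box (fst e) (snd e))" for e :: "mono \<times> nat set"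
  have "\<exists>m'. hit e \<longrightarrow> (\<forall>q. mscale a q \<in> box (fst e) (snd e) \<longleftrightarrow> q \<in> box m' (snd e))" for e
    using box_pullback[OF a, of "fst e" "snd e"] by (auto simp: hit_def)
  then obtain c where c: "\<And>e q. hit e \<Longrightarrow>
      mscale a q \<in> box (fst e) (snd e) \<longleftrightarrow> q \<in> box (c e) (snd e)"
    by metis
  define h where "h e = (c e, snd e)" for e
  define E' where "E' = h ` {e \<in> E. hit e}"
  have uniq: "\<exists>!e. e \<in> E \<and> q \<in> box (fst e) (snd e)" if "q \<in> Q - P" for q
    using E that by (simp add: box_partition_def)
  have sub: "box (fst e) (snd e) \<subseteq> Q - P" "snd e \<subseteq> {1..n}" if "e \<in> E" for e
    using E that by (auto simp: box_partition_def split_beta)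
  have "finite E'"
    using E by (simp add: E'_def box_partition_def)
  moreover have "\<forall>(m, Z) \<in> E'. Z \<subseteq> {1..n} \<and> box m Z \<subseteq> mono_radical Q - mono_radical P"
  proof -
    have "snd e' \<subseteq> {1..n} \<and> box (fst e') (snd e') \<subseteq> mono_radical Q - mono_radical P"
      if e': "e' \<in> E'" for e'
    proof -
      obtain e where e: "e' = h e" "e \<in> E" "hit e" using e' by (auto simp: E'_def)
      have "q \<in> mono_radical Q - mono_radical P" if "q \<in> box (fst e') (snd e')" for q
        using that e(1) c[OF e(3), of q] sub(1)[OF e(2)] rad[of q] by (auto simp: h_def)
      then show ?thesis using sub(2)[OF e(2)] e(1) by (auto simp: h_def)
    qed
    then show ?thesis by fastforce
  qed
  moreover have "\<exists>!e'. e' \<in> E' \<and> q \<in> box (fst e') (snd e')"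
    if q: "q \<in> mono_radical Q - mono_radical P" for q
  proof -
    have "mscale a q \<in> Q - P" using q rad by blast
    then obtain e where e: "e \<in> E" "mscale a q \<in> box (fst e) (snd e)"
      and e1: "\<And>e2. e2 \<in> E \<Longrightarrow> mscale a q \<in> box (fst e2) (snd e2) \<Longrightarrow> e2 = e"
      using uniq by metis
    have "hit e" using e by (auto simp: hit_def)
    show ?thesis
    proof (rule ex1I[of _ "h e"])
      show "h e \<in> E' \<and> q \<in> box (fst (h e)) (snd (h e))"
        using e \<open>hit e\<close> c by (auto simp: E'_def h_def)
      fix e' assume "e' \<in> E' \<and> q \<in> box (fst e') (snd e')"
      then show "e' = h e" using e1 c by (auto simp: E'_def h_def)
    qed
  qed
  ultimately have "box_partition n (mono_radical Q - mono_radical P) E'"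
    unfolding box_partition_def by blast
  moreover have "snd ` E' \<subseteq> snd ` E" by (force simp: E'_def h_def)
  ultimately show ?thesis by blast
qed

section \<open>The quotient of two monomial ideals\<close>

text \<open>In the fine grading a degree determines the exponent vector, so each component has
  dimension at most one. The zero polynomial is covered by \<open>c = 0\<close>.\<close>

lemma S_comp_single:
  assumes "f \<in> S_comp n a"
  obtains m c where "f = single m c"
proof -
  have eq: "m = m'" if "m \<in> keys f" "m' \<in> keys f" for m m'
  proof (rule poly_mapping_eqI)
    fix i
    have "int (lookup m i) = int (lookup m' i)" using assms that by (simp add: S_comp_def)
    then show "lookup m i = lookup m' i" by simp
  qed
  show ?thesis
  proof (cases "f = 0")
    case True
    then show ?thesis using that[of 0 0] by simp
  next
    case False
    then obtain m where "m \<in> keys f" using keys_eq_empty[of f] by blast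
    then have "keys f = {m}" using eq by blast
    then have "f = single m (lookup f m)" using poly_eq_sum[of f] by simp
    then show ?thesis by (rule that)
  qed
qed

text \<open>Serves twice in the main proof: for J/I, and for the quotient of the radicals. All
  computations in \<open>M\<close> are done on representatives in \<open>polys Q\<close> modulo
  \<open>polys P\<close>.\<close>

locale monomial_quotient =
  fixes n :: nat and P Q :: "mono set" and M :: "('k::field mpoly, 'k mpoly set) graded_module"
  assumes P: "mono_ideal n P" and Q: "mono_ideal n Q"
    and M_def: "M = quot_module n (polys Q) (polys P)"
begin

definition coset :: "'k mpoly \<Rightarrow> 'k mpoly set" where
  "coset f = polys P +>\<^bsub>S_ring n\<^esub> f"

lemma polys_Q_sub: "(polys Q :: 'k mpoly set) \<subseteq> polys (monoms {1..n})"
  by (intro polys_mono mono_ideal_monoms Q)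

lemma mem_coset_iff: "h \<in> coset f \<longleftrightarrow> h - f \<in> polys P"
proof
  assume "h - f \<in> polys P"
  then have "(h - f) + f \<in> coset f"
    unfolding coset_def a_r_coset_def' mpoly_ring_simps by blast
  then show "h \<in> coset f" by simp
qed (auto simp: coset_def a_r_coset_def')

lemma coset_eq_iff: "coset f = coset g \<longleftrightarrow> f - g \<in> polys P"
proof
  have "f \<in> coset f" by (simp add: mem_coset_iff)
  moreover assume "coset f = coset g"
  ultimately show "f - g \<in> polys P" by (simp add: mem_coset_iff)
next
  assume d: "f - g \<in> polys P"
  have "h - f \<in> polys P \<longleftrightarrow> h - g \<in> polys P" for h
    using polys_add[OF _ d, of "h - f"] polys_diff[OF _ d, of "h - g"] by auto
  then show "coset f = coset g" by (simp add: set_eq_iff mem_coset_iff)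
qed

lemma coset_eq_zero_iff: "coset f = coset 0 \<longleftrightarrow> f \<in> polys P"
  by (simp add: coset_eq_iff)

lemma carrier_M: "carrier M = coset ` polys Q"
  by (simp add: M_def quot_module_def Let_def coset_def)

lemma comp_M: "comp M a = coset ` (polys Q \<inter> S_comp n a)"
  by (simp add: M_def quot_module_def Let_def coset_def)

lemma zero_M: "\<zero>\<^bsub>M\<^esub> = coset 0"
  by (auto simp: M_def quot_module_def Let_def coset_def FactRing_def a_r_coset_def')

lemma add_M:
  assumes "f \<in> polys Q" "g \<in> polys Q"
  shows "coset f \<oplus>\<^bsub>M\<^esub> coset g = coset (f + g)"
proof -
  interpret ideal "polys P" "S_ring n :: 'k mpoly ring" by (rule ideal_polys[OF P])
  show ?thesis
    using assms polys_Q_sub a_rcos_sum[of f g]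
    by (auto simp: M_def quot_module_def Let_def coset_def FactRing_def)
qed

lemma smult_M:
  assumes "s \<in> polys (monoms {1..n})" "f \<in> polys Q"
  shows "s \<odot>\<^bsub>M\<^esub> coset f = coset (s * f)"
proof -
  interpret ideal "polys P" "S_ring n :: 'k mpoly ring" by (rule ideal_polys[OF P])
  show ?thesis
    using assms polys_Q_sub rcoset_mult_add[of s f]
    by (auto simp: M_def quot_module_def Let_def coset_def FactRing_def)
qed

section \<open>Sums and subspaces of J/I on representatives\<close>

lemma abelian_monoid_image:
  assumes "V \<subseteq> polys Q" "0 \<in> V" "\<And>f g. f \<in> V \<Longrightarrow> g \<in> V \<Longrightarrow> f + g \<in> V"
  shows "abelian_monoid (M\<lparr>carrier := coset ` V\<rparr>)"
  by (rule abelian_monoidI)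
     (use assms in \<open>auto simp: zero_M add_M subset_iff ac_simps\<close>)

text \<open>\<open>finsum\<close> depends on the carrier, so sums in \<open>M\<close> and in a
  Stanley space regarded as a module of its own are formally different. A general \<open>V\<close>
  covers both: \<open>polys Q\<close> for \<open>M\<close> itself, a lifted Stanley space for
  questions of freeness.\<close>

lemma finsum_image:
  assumes V: "V \<subseteq> polys Q" "0 \<in> V" "\<And>f g. f \<in> V \<Longrightarrow> g \<in> V \<Longrightarrow> f + g \<in> V"
    and "finite A" and "\<And>i. i \<in> A \<Longrightarrow> f i \<in> V" and "\<And>i. i \<in> A \<Longrightarrow> F i = coset (f i)"
  shows "finsum (M\<lparr>carrier := coset ` V\<rparr>) F A = coset (sum f A)"
proof -
  interpret abelian_monoid "M\<lparr>carrier := coset ` V\<rparr>"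
    by (rule abelian_monoid_image[OF V])
  have "finsum (M\<lparr>carrier := coset ` V\<rparr>) F A = coset (sum f A) \<and> sum f A \<in> V"
    using assms(4-6)
  proof (induction A rule: finite_induct)
    case empty
    then show ?case using V by (simp add: zero_M)
  next
    case (insert a A)
    have "finsum (M\<lparr>carrier := coset ` V\<rparr>) F (insert a A)
        = F a \<oplus>\<^bsub>M\<^esub> finsum (M\<lparr>carrier := coset ` V\<rparr>) F A"
      using insert by (subst finsum_insert) (auto simp: Pi_def)
    also have "\<dots> = coset (f a + sum f A)"
      using insert V(1) by (auto simp: add_M subset_iff)
    finally show ?case using insert V by simp
  qed
  then show ?thesis by simp
qed

lemma finsum_M:
  assumes "finite A" "\<And>i. i \<in> A \<Longrightarrow> f i \<in> polys Q" "\<And>i. i \<in> A \<Longrightarrow> F i = coset (f i)"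
  shows "finsum M F A = coset (sum f A)"
proof -
  have "M\<lparr>carrier := coset ` polys Q\<rparr> = M" by (simp flip: carrier_M)
  then show ?thesis
    using finsum_image[of "polys Q" A f F] assms by (simp add: polys_add)
qed

lemma inv_M:
  assumes "f \<in> polys Q"
  shows "inv\<^bsub>add_monoid M\<^esub> (coset f) = coset (- f)"
proof -
  have "abelian_group M"
  proof (rule abelian_groupI)
    fix x assume "x \<in> carrier M"
    then obtain g where "x = coset g" "g \<in> polys Q" by (auto simp: carrier_M)
    then show "\<exists>y \<in> carrier M. y \<oplus>\<^bsub>M\<^esub> x = \<zero>\<^bsub>M\<^esub>"
      by (intro bexI[of _ "coset (- g)"]) (auto simp: carrier_M add_M zero_M polys_uminus)
  qed (auto simp: carrier_M add_M zero_M polys_add ac_simps)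
  then interpret abelian_group M .
  have "\<ominus>\<^bsub>M\<^esub> coset f = coset (- f)"
    by (rule minus_equality) (use assms in \<open>auto simp: carrier_M add_M zero_M polys_uminus\<close>)
  then show ?thesis by (simp add: a_inv_def)
qed

lemma const_poly_monoms: "const_poly c \<in> polys (monoms Z)"
  by (simp add: polys_single)

lemma submodule_image:
  assumes "V \<subseteq> polys Q" "0 \<in> V" "\<And>f g. f \<in> V \<Longrightarrow> g \<in> V \<Longrightarrow> f + g \<in> V"
    and c: "\<And>c f. f \<in> V \<Longrightarrow> const_poly c * f \<in> V"
  shows "submodule (coset ` V) (ring_of_type_algebra :: 'k ring) (restrict_scalars M)"
proof -
  have neg: "- f \<in> V" if "f \<in> V" for f
    using c[OF that, of "- 1"] by (simp add: single_uminus)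
  have inv: "inv\<^bsub>add_monoid (restrict_scalars M)\<^esub> x = inv\<^bsub>add_monoid M\<^esub> x" for x
    by (simp add: restrict_scalars_def m_inv_def)
  have inv_closed: "inv\<^bsub>add_monoid (restrict_scalars M)\<^esub> x \<in> coset ` V" if "x \<in> coset ` V" for x
    using that assms(1) neg unfolding inv by (auto simp: inv_M subset_iff)
  have "subgroup (coset ` V) (add_monoid (restrict_scalars M))"
    by (rule subgroup.intro[OF _ _ _ inv_closed])
       (use assms in \<open>auto simp: restrict_scalars_def carrier_M add_M zero_M subset_iff\<close>)
  moreover have "const_poly c \<odot>\<^bsub>M\<^esub> x \<in> coset ` V" if "x \<in> coset ` V" for c x
    using that assms(1) c by (auto simp: smult_M const_poly_monoms subset_iff)
  ultimately show ?thesis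
    by (simp add: submodule_def submodule_axioms_def restrict_scalars_def)
qed

section \<open>The spaces wK[Z] and their freeness\<close>

definition multiples :: "nat set \<Rightarrow> 'k mpoly \<Rightarrow> 'k mpoly set" where
  "multiples Z w = (\<lambda>g. g * w) ` polys (monoms Z)"

lemma multiples_I: "g \<in> polys (monoms Z) \<Longrightarrow> g * w \<in> multiples Z w"
  unfolding multiples_def by (rule imageI)

lemma multiples_0: "0 \<in> multiples Z w"
  using multiples_I[of 0 Z w, OF polys_0] by simp

lemma multiples_add: "f \<in> multiples Z w \<Longrightarrow> g \<in> multiples Z w \<Longrightarrow> f + g \<in> multiples Z w"
  using multiples_I[OF polys_add] by (fastforce simp: multiples_def distrib_right)

lemma multiples_mult: "s \<in> polys (monoms Z) \<Longrightarrow> f \<in> multiples Z w \<Longrightarrow> s * f \<in> multiples Z w"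
  using multiples_I[OF polys_monoms_mult] by (fastforce simp: multiples_def mult.assoc)

lemma multiples_polys:
  assumes "w \<in> polys Q" "Z \<subseteq> {1..n}"
  shows "multiples Z w \<subseteq> polys Q"
  using polys_ideal_mult[OF Q assms(1)] polys_mono[OF monoms_mono[OF assms(2)]]
  by (auto simp: multiples_def mult.commute)

text \<open>The image of K[Z]w is a K-subspace containing the generators, so it contains their span.
  Conversely, any subspace containing the cosets of all x^v w contains that of g w, by induction on
  the terms of g.\<close>

lemma mono_space_coset:
  assumes w: "w \<in> polys Q" and Z: "Z \<subseteq> {1..n}"
  shows "mono_space M (coset w) Z = coset ` multiples Z w"
proof -
  let ?V = "multiples Z w"
  let ?W = "{monom_poly v \<odot>\<^bsub>M\<^esub> coset w | v. keys v \<subseteq> Z}"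
  have ZS: "(polys (monoms Z) :: 'k mpoly set) \<subseteq> polys (monoms {1..n})"
    by (intro polys_mono monoms_mono Z)
  have VQ: "?V \<subseteq> polys Q" by (rule multiples_polys[OF w Z])
  have sm: "monom_poly v \<odot>\<^bsub>M\<^esub> coset w = coset (monom_poly v * w)" if "keys v \<subseteq> Z" for v
    using that Z by (intro smult_M w polys_single) (auto simp: monoms_def)
  have sub: "submodule (coset ` ?V) (ring_of_type_algebra :: 'k ring) (restrict_scalars M)"
    by (rule submodule_image[OF VQ multiples_0 multiples_add])
       (auto intro: multiples_mult const_poly_monoms)
  have "mono_space M (coset w) Z \<subseteq> coset ` ?V"
  proof -
    have "?W \<subseteq> coset ` ?V"
      using sm by (auto intro!: imageI multiples_I polys_single simp: monoms_def)
    then show ?thesis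
      using sub by (auto simp: mono_space_def K_span_def)
  qed
  moreover have "coset (g * w) \<in> V"
    if V: "submodule V (ring_of_type_algebra :: 'k ring) (restrict_scalars M)" "?W \<subseteq> V"
      and g: "g \<in> polys (monoms Z)" for g V
  proof -
    interpret V: submodule V "ring_of_type_algebra :: 'k ring" "restrict_scalars M" by fact
    have in_Q: "g * w \<in> polys Q" if "g \<in> polys (monoms Z)" for g
      using VQ multiples_I[OF that] by auto
    show ?thesis
      using g
    proof (induction rule: polys_induct)
      case zero
      then show ?case using V.one_closed by (simp add: restrict_scalars_def zero_M)
    next
      case (add f g)
      then show ?case
        using V.m_closed[of "coset (f * w)" "coset (g * w)"] in_Q
        by (simp add: restrict_scalars_def add_M distrib_right)
    next
      case (single m c)
      have "coset (monom_poly m * w) \<in> V"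
        using V(2) single sm[of m] by (auto simp: monoms_def)
      then have "const_poly c \<odot>\<^bsub>M\<^esub> coset (monom_poly m * w) \<in> V"
        using V.smult_closed[of c]
        by (simp add: restrict_scalars_def ring_of_type_algebra_def)
      then show ?case
        using in_Q[of "monom_poly m"] single
        by (simp add: smult_M const_poly_monoms polys_single mult_single flip: mult.assoc)
    qed
  qed
  ultimately show ?thesis
    by (auto simp: mono_space_def K_span_def multiples_def)
qed

lemma monom_multiples_eq:
  assumes "c \<noteq> 0"
  shows "multiples Z (single m c) = (polys (box m Z) :: 'k mpoly set)"
proof (intro equalityI subsetI)
  fix f assume "f \<in> multiples Z (single m c)"
  then show "f \<in> polys (box m Z)"
    by (auto simp: multiples_def box_def ac_simps
        intro!: polys_mult[where T = "monoms Z" and Y = "{m}"] polys_single)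
next
  fix f :: "'k mpoly" assume "f \<in> polys (box m Z)"
  then show "f \<in> multiples Z (single m c)"
  proof (induction rule: polys_induct)
    case zero
    show ?case by (rule multiples_0)
  next
    case (add f g)
    then show ?case by (intro multiples_add)
  next
    case (single q d)
    then obtain v where "q = m + v" "v \<in> monoms Z" by (auto simp: box_def)
    then show ?case
      using assms multiples_I[OF polys_single[of v "monoms Z" "d / c"], of "single m c"]
      by (simp add: mult_single add.commute)
  qed
qed

lemma box_sub_Q: "m \<in> Q \<Longrightarrow> Z \<subseteq> {1..n} \<Longrightarrow> box m Z \<subseteq> Q"
  using monoms_mono[of Z "{1..n}"] by (auto simp: box_def intro!: mono_ideal_add[OF Q])

lemma mono_space_box:
  assumes "m \<in> Q" "Z \<subseteq> {1..n}" "c \<noteq> 0"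
  shows "mono_space M (coset (single m c)) Z = coset ` polys (box m Z)"
  using assms by (subst mono_space_coset) (auto simp: monom_multiples_eq polys_single)

text \<open>If x^v kills w in \<open>M\<close>, it kills all of wK[Z], in particular every basis
  element. Linear independence would then force x^v = 0, so the basis is empty, the module is zero
  and w vanishes in \<open>M\<close>.\<close>

lemma free_imp_nonzero_multiple:
  assumes w: "w \<in> polys Q" and Z: "Z \<subseteq> {1..n}" and v: "v \<in> monoms Z"
    and free: "free_module (mpoly_ring Z :: 'k mpoly ring) (M\<lparr>carrier := mono_space M (coset w) Z\<rparr>)"
    and vw: "monom_poly v * w \<in> polys P"
  shows "w \<in> polys P"
proof -
  let ?V = "multiples Z w"
  let ?N = "M\<lparr>carrier := coset ` ?V\<rparr>"
  have ZS: "(polys (monoms Z) :: 'k mpoly set) \<subseteq> polys (monoms {1..n})"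
    by (intro polys_mono monoms_mono Z)
  have VQ: "?V \<subseteq> polys Q" by (rule multiples_polys[OF w Z])
  note sum_N = finsum_image[OF VQ multiples_0 multiples_add]
  obtain B where B: "is_basis (mpoly_ring Z :: 'k mpoly ring) ?N B"
    using free by (auto simp: free_module_def mono_space_coset[OF w Z])
  have wV: "w \<in> ?V" using multiples_I[OF polys_monoms_1, of w Z] by simp
  show ?thesis
  proof (cases "B = {}")
    case True
    have "\<forall>x \<in> carrier ?N. \<exists>A c. finite A \<and> A \<subseteq> {} \<and> c \<in> A \<rightarrow> carrier (mpoly_ring Z :: 'k mpoly ring) \<and>
        x = (\<Oplus>\<^bsub>?N\<^esub>b \<in> A. c b \<odot>\<^bsub>?N\<^esub> b)"
      using B unfolding is_basis_def True by (elim conjE)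
    moreover have "coset w \<in> carrier ?N" using wV by simp
    ultimately obtain A and c :: "'k mpoly set \<Rightarrow> 'k mpoly"
      where "A \<subseteq> {}" "coset w = (\<Oplus>\<^bsub>?N\<^esub>b \<in> A. c b \<odot>\<^bsub>?N\<^esub> b)"
      by (elim ballE) auto
    then have "coset w = coset 0" using sum_N[of "{}"] by simp
    then show ?thesis by (simp add: coset_eq_zero_iff)
  next
    case False
    then obtain b where b: "b \<in> B" by blast
    moreover have "B \<subseteq> coset ` ?V" using B by (simp add: is_basis_def)
    ultimately have "b \<in> coset ` ?V" by (rule rev_subsetD)
    then obtain g where g: "g \<in> polys (monoms Z)" "b = coset (g * w)"
      unfolding multiples_def by blast
    have mv: "monom_poly v \<in> (polys (monoms Z) :: 'k mpoly set)" by (intro polys_single v)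
    have gw: "g * w \<in> polys Q" using multiples_I[OF g(1)] VQ by auto
    have mV: "monom_poly v * (g * w) \<in> ?V"
      by (intro multiples_mult mv multiples_I g)
    have "(\<Oplus>\<^bsub>?N\<^esub>b \<in> {b}. monom_poly v \<odot>\<^bsub>?N\<^esub> b) = coset (\<Sum>b \<in> {b}. monom_poly v * (g * w))"
      by (rule sum_N) (use mV mv ZS gw g in \<open>auto simp: smult_M subset_iff\<close>)
    also have "\<dots> = coset ((monom_poly v * w) * g)" by (simp add: ac_simps)
    also have "\<dots> = \<zero>\<^bsub>?N\<^esub>"
      using polys_ideal_mult[OF P vw] g ZS by (auto simp: zero_M coset_eq_zero_iff)
    finally have z: "(\<Oplus>\<^bsub>?N\<^esub>b \<in> {b}. monom_poly v \<odot>\<^bsub>?N\<^esub> b) = \<zero>\<^bsub>?N\<^esub>" .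
    have "\<forall>A c. finite A \<longrightarrow> A \<subseteq> B \<longrightarrow> c \<in> A \<rightarrow> carrier (mpoly_ring Z :: 'k mpoly ring) \<longrightarrow>
        (\<Oplus>\<^bsub>?N\<^esub>b \<in> A. c b \<odot>\<^bsub>?N\<^esub> b) = \<zero>\<^bsub>?N\<^esub> \<longrightarrow> (\<forall>b \<in> A. c b = \<zero>\<^bsub>mpoly_ring Z\<^esub>)"
      using B unfolding is_basis_def by (elim conjE)
    from this[rule_format, of "{b}" "\<lambda>_. monom_poly v" b] have "monom_poly v = (0 :: 'k mpoly)"
      using b mv z by simp
    then have "lookup (monom_poly v :: 'k mpoly) v = lookup 0 v" by simp
    then show ?thesis by simp
  qed
qed

text \<open>The coset of x^m alone is a basis: multiplication by x^m sends distinct monomials of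
  K[Z] to distinct monomials outside \<open>P\<close>, so no nonzero multiple of x^m by an element
  of K[Z] lies in \<open>polys P\<close>.\<close>

lemma free_box:
  assumes m: "m \<in> Q" and Z: "Z \<subseteq> {1..n}" and box: "box m Z \<inter> P = {}"
  shows "free_module (mpoly_ring Z :: 'k mpoly ring)
    (M\<lparr>carrier := mono_space M (coset (monom_poly m)) Z\<rparr>)"
proof -
  let ?w = "monom_poly m :: 'k mpoly"
  let ?V = "polys (box m Z) :: 'k mpoly set"
  let ?N = "M\<lparr>carrier := coset ` ?V\<rparr>"
  have ZS: "(polys (monoms Z) :: 'k mpoly set) \<subseteq> polys (monoms {1..n})"
    by (intro polys_mono monoms_mono Z)
  have V: "?V = multiples Z ?w" by (simp add: monom_multiples_eq)
  have VQ: "?V \<subseteq> polys Q" by (intro polys_mono box_sub_Q m Z)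
  have wV: "?w \<in> ?V" by (simp add: polys_single)
  note sum_N = finsum_image[OF VQ polys_0 polys_add]
  have sum1: "(\<Oplus>\<^bsub>?N\<^esub>b \<in> {coset ?w}. c b \<odot>\<^bsub>?N\<^esub> b) = coset (c (coset ?w) * ?w)"
    if c: "c (coset ?w) \<in> polys (monoms Z)" for c
  proof -
    have "(\<Oplus>\<^bsub>?N\<^esub>b \<in> {coset ?w}. c b \<odot>\<^bsub>?N\<^esub> b) = coset (\<Sum>b \<in> {coset ?w}. c (coset ?w) * ?w)"
      by (rule sum_N)
         (use c ZS V wV VQ multiples_I[OF c] in \<open>auto simp: smult_M subset_iff\<close>)
    then show ?thesis by simp
  qed
  have "is_basis (mpoly_ring Z :: 'k mpoly ring) ?N {coset ?w}"
    unfolding is_basis_def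
  proof (intro conjI ballI allI impI)
    show "{coset ?w} \<subseteq> carrier ?N" using wV by simp
  next
    fix x assume "x \<in> carrier ?N"
    then obtain g where "g \<in> polys (monoms Z)" "x = coset (g * ?w)" by (auto simp: V multiples_def)
    then show "\<exists>A c. finite A \<and> A \<subseteq> {coset ?w} \<and> c \<in> A \<rightarrow> carrier (mpoly_ring Z) \<and>
        x = (\<Oplus>\<^bsub>?N\<^esub>b \<in> A. c b \<odot>\<^bsub>?N\<^esub> b)"
      using sum1[of "\<lambda>_. g"] by (intro exI[of _ "{coset ?w}"] exI[of _ "\<lambda>_. g"]) auto
  next
    fix A c b
    assume A: "A \<subseteq> {coset ?w}" "b \<in> A" and c: "c \<in> A \<rightarrow> carrier (mpoly_ring Z :: 'k mpoly ring)"
      and z: "(\<Oplus>\<^bsub>?N\<^esub>b \<in> A. c b \<odot>\<^bsub>?N\<^esub> b) = \<zero>\<^bsub>?N\<^esub>"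
    have b: "b = coset ?w" "A = {coset ?w}" using A by auto
    have cb: "c b \<in> polys (monoms Z)" using c A by auto
    have "coset (c b * ?w) = coset 0"
      using z sum1[of c] cb by (simp add: b zero_M)
    then have cP: "c b * ?w \<in> polys P" by (simp add: coset_eq_zero_iff)
    have "lookup (c b) q = 0" for q
    proof (rule ccontr)
      assume q: "lookup (c b) q \<noteq> 0"
      then have "q + m \<in> keys (c b * ?w)" by (simp add: in_keys_iff lookup_mult_monom)
      then have "q + m \<in> P" using cP by (auto simp: polys_def)
      moreover have "q + m \<in> box m Z"
        using q cb by (auto simp: box_def polys_def in_keys_iff add.commute)
      ultimately show False using box by blast
    qed
    then show "c b = \<zero>\<^bsub>mpoly_ring Z\<^esub>" by (intro poly_mapping_eqI) simp
  qed
  then show ?thesis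
    using m Z by (auto simp: free_module_def mono_space_box)
qed

section \<open>Stanley decompositions and box partitions\<close>

text \<open>The zero module is free, so a decomposition may contain summands \<open>0K[Z]\<close>; they are
  discarded here.\<close>

lemma stanley_decomposition_imp_box_partition:
  assumes D: "stanley_decomposition n M D"
  shows "\<exists>E. box_partition n (Q - P) E \<and> snd ` E \<subseteq> snd ` set D"
proof -
  define L where "L = {..<length D}"
  define Z where "Z i = snd (D ! i)" for i
  have st: "stanley_space n M (fst (D ! i)) (Z i)" if "i \<in> L" for i
    using D that nth_mem[of i D] by (auto simp: stanley_decomposition_def L_def Z_def split_beta)
  then have Z: "Z i \<subseteq> {1..n}" if "i \<in> L" for i
    using that by (auto simp: stanley_space_def)
  \<comment> \<open>Homogeneity of the generators enters here: each has a representative with at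
    most one term.\<close>
  have "\<exists>m c. fst (D ! i) = coset (single m c) \<and> single m c \<in> polys Q" if "i \<in> L" for i
  proof -
    obtain a where "fst (D ! i) \<in> comp M a"
      using st[OF \<open>i \<in> L\<close>] by (auto simp: stanley_space_def homogeneous_def)
    then obtain f where "fst (D ! i) = coset f" "f \<in> polys Q" "f \<in> S_comp n a"
      by (auto simp: comp_M)
    then show ?thesis by (metis S_comp_single)
  qed
  then obtain m c where u: "\<And>i. i \<in> L \<Longrightarrow> fst (D ! i) = coset (single (m i) (c i))"
    and wQ: "\<And>i. i \<in> L \<Longrightarrow> single (m i) (c i) \<in> polys Q"
    by metis
  define w where "w i = single (m i) (c i)" for i
  have space: "mono_space M (fst (D ! i)) (snd (D ! i)) = coset ` multiples (Z i) (w i)"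
    if "i \<in> L" for i
    using mono_space_coset[OF wQ[OF that] Z[OF that]] u[OF that] by (simp add: w_def Z_def)
  \<comment> \<open>The indices whose generator is nonzero in \<open>M\<close>; only these give
    boxes.\<close>
  define alive where "alive = {i \<in> L. w i \<notin> polys P}"
  have alive: "i \<in> L" "c i \<noteq> 0" "m i \<in> Q" if "i \<in> alive" for i
    using that wQ[of i] by (auto simp: alive_def w_def polys_single_iff)
  \<comment> \<open>A monomial of the box inside \<open>P\<close> would be a multiple of the
    generator vanishing in \<open>M\<close>; freeness would make the generator itself zero.\<close>
  have box: "box (m i) (Z i) \<subseteq> Q - P" if i: "i \<in> alive" for i
  proof -
    have "m i + v \<notin> P" if v: "v \<in> monoms (Z i)" for v
    proof
      assume "m i + v \<in> P"
      then have "monom_poly v * single (m i) (c i) \<in> polys P"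
        by (simp add: mult_single add.commute polys_single)
      then have "single (m i) (c i) \<in> polys P"
        using free_imp_nonzero_multiple[OF wQ Z v] st[of i] u[of i] alive(1)[OF i]
        by (auto simp: stanley_space_def)
      then show False using i by (simp add: alive_def w_def)
    qed
    then show ?thesis
      using box_sub_Q[OF alive(3)[OF i] Z[OF alive(1)[OF i]]] by (auto simp: box_def)
  qed
  have ex1: "\<exists>!f. f \<in> (\<Pi>\<^sub>E i \<in> L. mono_space M (fst (D ! i)) (snd (D ! i))) \<and>
      x = (\<Oplus>\<^bsub>M\<^esub>i \<in> L. f i)" if "x \<in> carrier M" for x
    using D that by (auto simp: stanley_decomposition_def L_def)
  have cover: "\<exists>i \<in> alive. q \<in> box (m i) (Z i)" if q: "q \<in> Q - P" for q
  proof -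
    have "coset (monom_poly q) \<in> carrier M" using q by (auto simp: carrier_M polys_single)
    from ex1[OF this] obtain f where f: "f \<in> (\<Pi>\<^sub>E i \<in> L. mono_space M (fst (D ! i)) (snd (D ! i)))"
      and fs: "coset (monom_poly q) = (\<Oplus>\<^bsub>M\<^esub>i \<in> L. f i)" by blast
    have "\<exists>g. g \<in> polys (monoms (Z i)) \<and> f i = coset (g * w i)" if "i \<in> L" for i
      using PiE_mem[OF f that] space[OF that] by (auto simp: multiples_def)
    then obtain g where g: "\<And>i. i \<in> L \<Longrightarrow> g i \<in> polys (monoms (Z i))"
      and fg: "\<And>i. i \<in> L \<Longrightarrow> f i = coset (g i * w i)" by metis
    have gS: "g i \<in> polys (monoms {1..n})" if "i \<in> L" for i
      using g[OF that] polys_mono[OF monoms_mono[OF Z[OF that]]] by auto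
    have "g i * w i \<in> polys Q" if "i \<in> L" for i
      using polys_ideal_mult[OF Q wQ[OF that] gS[OF that]] by (simp add: w_def mult.commute)
    then have "(\<Oplus>\<^bsub>M\<^esub>i \<in> L. f i) = coset (\<Sum>i \<in> L. g i * w i)"
      by (intro finsum_M) (auto simp: L_def fg)
    then have "monom_poly q - (\<Sum>i \<in> L. g i * w i) \<in> polys P"
      using fs by (simp add: coset_eq_iff)
    \<comment> \<open>Since \<open>q\<close> is outside \<open>P\<close>, the coefficient at
      \<open>q\<close> is the same for all representatives of a coset. It is 1 for x^q, so some
      summand must contain \<open>q\<close>.\<close>
    then have "lookup (monom_poly q - (\<Sum>i \<in> L. g i * w i)) q = 0"
      using q by (auto simp: polys_def in_keys_iff)
    then have "(\<Sum>i \<in> L. lookup (g i * w i) q) \<noteq> 0"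
      by (simp add: lookup_minus lookup_sum)
    then obtain i where i: "i \<in> L" "q \<in> keys (g i * w i)"
      by (meson in_keys_iff sum.neutral)
    have "i \<in> alive"
    proof (rule ccontr)
      assume "i \<notin> alive"
      then have "w i * g i \<in> polys P"
        using i gS by (intro polys_ideal_mult[OF P]) (auto simp: alive_def)
      then show False using i q by (auto simp: polys_def mult.commute)
    qed
    moreover have "g i * w i \<in> polys (box (m i) (Z i))"
      using monom_multiples_eq[OF alive(2)[OF \<open>i \<in> alive\<close>]] multiples_I[OF g[OF i(1)]]
      by (auto simp: w_def)
    ultimately show ?thesis using i by (auto simp: polys_def)
  qed
  have disj: "i = j" if i: "i \<in> alive" and j: "j \<in> alive"
    and q: "q \<in> box (m i) (Z i)" "q \<in> box (m j) (Z j)" for i j q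
  proof -
    have qQ: "q \<in> Q" "q \<notin> P" using box[OF i] q by auto
    \<comment> \<open>Puts x^q into slot \<open>k\<close> and 0 elsewhere. If \<open>q\<close> were
      in two boxes, this would give two decompositions of the same coset, which is nonzero as
      \<open>q\<close> is outside \<open>P\<close>.\<close>
    define F where "F k = (\<lambda>l \<in> L. coset (if l = k then monom_poly q else 0))" for k
    have F: "F k \<in> (\<Pi>\<^sub>E i \<in> L. mono_space M (fst (D ! i)) (snd (D ! i))) \<and>
        coset (monom_poly q) = (\<Oplus>\<^bsub>M\<^esub>i \<in> L. F k i)"
      if k: "k \<in> alive" "q \<in> box (m k) (Z k)" for k
    proof
      have "monom_poly q \<in> multiples (Z k) (w k)"
        using k monom_multiples_eq[of "c k" "Z k" "m k"] alive(2)[OF k(1)]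
        by (simp add: w_def polys_single)
      moreover have "0 \<in> multiples (Z l) (w l)" for l
        by (rule multiples_0)
      ultimately show "F k \<in> (\<Pi>\<^sub>E i \<in> L. mono_space M (fst (D ! i)) (snd (D ! i)))"
        unfolding F_def by (intro restrict_PiE_iff[THEN iffD2] ballI) (auto simp: space)
      have "(\<Oplus>\<^bsub>M\<^esub>i \<in> L. F k i) = coset (\<Sum>l \<in> L. if l = k then monom_poly q else 0)"
        using qQ by (intro finsum_M) (auto simp: F_def L_def polys_single)
      then show "coset (monom_poly q) = (\<Oplus>\<^bsub>M\<^esub>i \<in> L. F k i)"
        using alive(1)[OF k(1)] by (simp add: L_def)
    qed
    have "coset (monom_poly q) \<in> carrier M" using qQ by (auto simp: carrier_M polys_single)
    then have "F i = F j" using ex1 F[OF i q(1)] F[OF j q(2)] by blast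
    then have "F i i = F j i" by simp
    then show "i = j"
      using alive(1)[OF i] qQ by (auto simp: F_def coset_eq_zero_iff polys_single_iff split: if_splits)
  qed
  define E where "E = (\<lambda>i. (m i, Z i)) ` alive"
  have "finite E" by (simp add: E_def alive_def L_def)
  moreover have "Z i \<subseteq> {1..n} \<and> box (m i) (Z i) \<subseteq> Q - P" if "i \<in> alive" for i
    using box[OF that] Z[OF alive(1)[OF that]] by blast
  moreover have "\<exists>!e. e \<in> E \<and> q \<in> box (fst e) (snd e)" if q: "q \<in> Q - P" for q
  proof -
    obtain i where i: "i \<in> alive" "q \<in> box (m i) (Z i)" using cover[OF q] by blast
    show ?thesis
    proof (rule ex1I[of _ "(m i, Z i)"])
      fix e assume "e \<in> E \<and> q \<in> box (fst e) (snd e)"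
      then obtain j where j: "e = (m j, Z j)" "j \<in> alive" "q \<in> box (m j) (Z j)"
        by (auto simp: E_def)
      then have "i = j" using disj i by blast
      then show "e = (m i, Z i)" using j by simp
    qed (use i in \<open>auto simp: E_def\<close>)
  qed
  ultimately have "box_partition n (Q - P) E"
    by (auto simp: box_partition_def E_def)
  moreover have "snd ` E \<subseteq> snd ` set D"
    using nth_mem alive(1) by (fastforce simp: E_def Z_def L_def)
  ultimately show ?thesis by blast
qed

text \<open>The corner monomials generate the summands, and the components of the coset of f are the
  restrictions of f to the boxes: what the boxes miss of f lies in \<open>polys P\<close>.\<close>

lemma box_partition_imp_stanley_decomposition:
  assumes E: "box_partition n (Q - P) E"
  shows "\<exists>D. stanley_decomposition n M D \<and> snd ` set D = snd ` E"
proof -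
  \<comment> \<open>Without \<open>distinct\<close>, a box listed twice would destroy uniqueness of
    the components.\<close>
  obtain es where es: "distinct es" "set es = E"
    using E finite_distinct_list[of E] by (auto simp: box_partition_def)
  define D where "D = map (\<lambda>(m, Z). (coset (monom_poly m), Z)) es"
  define L where "L = {..<length es}"
  define B where "B i = box (fst (es ! i)) (snd (es ! i))" for i
  have Z: "Z \<subseteq> {1..n}" and bx: "box m Z \<subseteq> Q - P" if "(m, Z) \<in> E" for m Z
    using E that by (auto simp: box_partition_def)
  have mQ: "m \<in> Q" if "(m, Z) \<in> E" for m Z
    using bx[OF that] self_mem_box[of m Z] by blast
  have esE: "(fst (es ! i), snd (es ! i)) \<in> E" if "i \<in> L" for i
    using that es nth_mem[of i es] by (simp add: L_def)
  have BQ: "B i \<subseteq> Q - P" if "i \<in> L" for i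
    using bx[OF esE[OF that]] by (simp add: B_def)
  have disj: "i = j" if "i \<in> L" "j \<in> L" "q \<in> B i" "q \<in> B j" for i j q
  proof -
    have "q \<in> Q - P" using BQ that by auto
    then have "\<exists>!e. e \<in> E \<and> q \<in> box (fst e) (snd e)" using E by (simp add: box_partition_def)
    moreover have "es ! i \<in> E" "es ! j \<in> E" using that es by (auto simp: L_def)
    ultimately have "es ! i = es ! j" using that by (auto simp: B_def)
    then show ?thesis using es(1) that by (simp add: L_def nth_eq_iff_index_eq)
  qed
  have cover: "\<exists>i \<in> L. q \<in> B i" if q: "q \<in> Q - P" for q
  proof -
    obtain e where "e \<in> set es" "q \<in> box (fst e) (snd e)"
      using E q es unfolding box_partition_def by blast
    then show ?thesis unfolding in_set_conv_nth L_def B_def by blast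
  qed
  have lookup_B: "lookup (\<Sum>j \<in> L. h j) q = lookup (h i) q"
    if h: "\<And>j. j \<in> L \<Longrightarrow> h j \<in> polys (B j)" and i: "i \<in> L" "q \<in> B i" for h :: "nat \<Rightarrow> 'k mpoly" and i q
  proof -
    have "lookup (h j) q = 0" if "j \<in> L" "j \<noteq> i" for j
    proof -
      have "q \<notin> B j" using disj[OF that(1) i(1) _ i(2)] that(2) by blast
      then have "q \<notin> keys (h j)" using h[OF that(1)] by (auto simp: polys_def)
      then show ?thesis by (simp add: in_keys_iff)
    qed
    then have "(\<Sum>j \<in> L. lookup (h j) q) = (\<Sum>j \<in> {i}. lookup (h j) q)"
      using i by (intro sum.mono_neutral_right) (auto simp: L_def)
    then show ?thesis by (simp add: lookup_sum)
  qed
  have BP: "(polys (B i) :: 'k mpoly set) \<subseteq> polys Q" if "i \<in> L" for i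
    using BQ[OF that] by (intro polys_mono) auto
  have space: "mono_space M (fst (D ! i)) (snd (D ! i)) = coset ` polys (B i)" if "i \<in> L" for i
    using mono_space_box[OF mQ Z, OF esE esE, OF that that, of 1] that
    by (simp add: D_def B_def L_def split_beta)
  have stanley: "stanley_space n M (coset (monom_poly m)) Z" if e: "(m, Z) \<in> E" for m Z
  proof -
    have "m \<in> monoms {1..n}" using mQ[OF e] mono_ideal_monoms[OF Q] by auto
    then have "monom_poly m \<in> S_comp n (\<lambda>i. int (lookup m i))"
      by (auto simp: S_comp_def polys_single)
    then have "homogeneous M (coset (monom_poly m))"
      using mQ[OF e] polys_single unfolding homogeneous_def comp_M by blast
    moreover have "box m Z \<inter> P = {}" using bx[OF e] by blast
    ultimately show ?thesis
      using free_box[OF mQ[OF e] Z[OF e]] Z[OF e] unfolding stanley_space_def by blast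
  qed
  have "\<exists>!F. F \<in> (\<Pi>\<^sub>E i \<in> L. mono_space M (fst (D ! i)) (snd (D ! i))) \<and> x = (\<Oplus>\<^bsub>M\<^esub>i \<in> L. F i)"
    if "x \<in> carrier M" for x
  proof -
    obtain f where f: "f \<in> polys Q" "x = coset f" using \<open>x \<in> carrier M\<close> by (auto simp: carrier_M)
    let ?r = "\<lambda>i. restrict_poly f (B i)"
    have rQ: "?r i \<in> polys Q" if "i \<in> L" for i using BP[OF that] restrict_poly_polys by blast
    show ?thesis
    proof (rule ex1I[of _ "\<lambda>i \<in> L. coset (?r i)"], intro conjI)
      show "(\<lambda>i \<in> L. coset (?r i)) \<in> (\<Pi>\<^sub>E i \<in> L. mono_space M (fst (D ! i)) (snd (D ! i)))"
        using restrict_poly_polys by (intro restrict_PiE_iff[THEN iffD2] ballI) (auto simp: space)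
      have "f - sum ?r L \<in> polys P"
        unfolding polys_def
      proof (intro CollectI subsetI, rule ccontr)
        fix q assume q: "q \<in> keys (f - sum ?r L)" "q \<notin> P"
        have "f - sum ?r L \<in> polys Q" by (intro polys_diff f polys_sum rQ)
        then have "q \<in> Q - P" using q by (auto simp: polys_def)
        then obtain i where i: "i \<in> L" "q \<in> B i" using cover by blast
        then have "lookup (sum ?r L) q = lookup f q"
          using lookup_B[where h = ?r, OF restrict_poly_polys i] by simp
        then show False using q by (simp add: in_keys_iff lookup_minus)
      qed
      moreover have "(\<Oplus>\<^bsub>M\<^esub>i \<in> L. (\<lambda>i \<in> L. coset (?r i)) i) = coset (sum ?r L)"
        by (rule finsum_M) (auto simp: L_def intro: rQ[unfolded L_def])
      ultimately show "x = (\<Oplus>\<^bsub>M\<^esub>i \<in> L. (\<lambda>i \<in> L. coset (?r i)) i)"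
        using f by (simp add: coset_eq_iff)
    next
      fix F assume F: "F \<in> (\<Pi>\<^sub>E i \<in> L. mono_space M (fst (D ! i)) (snd (D ! i))) \<and>
        x = (\<Oplus>\<^bsub>M\<^esub>i \<in> L. F i)"
      have "\<exists>h. h \<in> polys (B i) \<and> F i = coset h" if "i \<in> L" for i
        using PiE_mem[OF conjunct1[OF F] that] space[OF that] by auto
      then obtain h where h: "\<And>i. i \<in> L \<Longrightarrow> h i \<in> polys (B i)"
        and Fh: "\<And>i. i \<in> L \<Longrightarrow> F i = coset (h i)" by metis
      have "(\<Oplus>\<^bsub>M\<^esub>i \<in> L. F i) = coset (sum h L)"
        by (rule finsum_M) (use h Fh BP in \<open>auto simp: L_def subset_iff\<close>)
      then have d: "f - sum h L \<in> polys P" using F f by (simp add: coset_eq_iff)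
      \<comment> \<open>On the box \<open>B i\<close> only \<open>h i\<close> contributes to the
        sum, and there the coefficients are determined by f, since the box avoids \<open>P\<close>;
        off the box both sides vanish.\<close>
      have "h i = ?r i" if i: "i \<in> L" for i
      proof (rule poly_mapping_eqI)
        fix q
        show "lookup (h i) q = lookup (?r i) q"
        proof (cases "q \<in> B i")
          case True
          then have "q \<notin> P" using BQ[OF i] by auto
          then have "lookup (f - sum h L) q = 0" using d by (auto simp: polys_def in_keys_iff)
          then show ?thesis using True lookup_B[OF h i True] by (simp add: lookup_minus)
        next
          case False
          then show ?thesis using h[OF i] by (auto simp: polys_def in_keys_iff)
        qed
      qed
      then show "F = (\<lambda>i \<in> L. coset (?r i))"
        using F Fh by (intro extensionalityI[of F L]) (auto simp: PiE_def)
    qed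
  qed
  then have "stanley_decomposition n M D"
    using stanley es by (auto simp: stanley_decomposition_def D_def L_def split_beta)
  moreover have "snd ` set D = snd ` E"
    using es by (force simp: D_def)
  ultimately show ?thesis by blast
qed

end

text \<open>A minimum over fewer sets is at least as large. An empty \<open>D'\<close> has depth
  infinity, so radicals that coincide, as for I = (x^2) and J = (x), need no separate case.\<close>

lemma sdepth_decomp_mono:
  fixes D D' :: "('a \<times> nat set) list"
  assumes "snd ` set D' \<subseteq> snd ` set D"
  shows "sdepth_decomp D \<le> sdepth_decomp D'"
proof -
  have "sdepth_decomp D = (INF Z \<in> snd ` set D. enat (card Z))" for D :: "('a \<times> nat set) list"
    by (simp add: sdepth_decomp_def split_beta image_image)
  then show ?thesis
    using INF_superset_mono[OF assms, of "\<lambda>Z. enat (card Z)" "\<lambda>Z. enat (card Z)"] by simp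
qed

theorem theorem2p1:
  fixes n :: nat and I J :: "'k::field mpoly set"
  assumes "monomial_ideal n I" and "monomial_ideal n J" and "I \<subseteq> J"
  shows "sdepth n (quot_module n J I)
       \<le> sdepth n (quot_module n (ideal_radical (S_ring n) J) (ideal_radical (S_ring n) I))"
proof -
  obtain P where P: "mono_ideal n P" "I = polys P"
    using monomial_ideal_eq_polys[OF assms(1)] .
  obtain Q where Q: "mono_ideal n Q" "J = polys Q"
    using monomial_ideal_eq_polys[OF assms(2)] .
  define M where "M = quot_module n J I"
  define N where "N = quot_module n (ideal_radical (S_ring n) J) (ideal_radical (S_ring n) I)"
  interpret M: monomial_quotient n P Q M
    by unfold_locales (use P Q in \<open>auto simp: M_def\<close>)
  \<comment> \<open>By \<open>radical_polys\<close> both radicals are again spans of monomials, so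
    the same locale applies to their quotient.\<close>
  interpret N: monomial_quotient n "mono_radical P" "mono_radical Q" N
    by unfold_locales
       (use P Q mono_ideal_radical in \<open>auto simp: N_def radical_polys\<close>)
  have "sdepth_decomp D \<le> sdepth n N" if D: "stanley_decomposition n M D" for D
  proof -
    obtain E where E: "box_partition n (Q - P) E" "snd ` E \<subseteq> snd ` set D"
      using M.stanley_decomposition_imp_box_partition[OF D] by blast
    obtain E' where E': "box_partition n (mono_radical Q - mono_radical P) E'" "snd ` E' \<subseteq> snd ` E"
      using box_partition_radical[OF P(1) Q(1) E(1)] by blast
    obtain D' where D': "stanley_decomposition n N D'" "snd ` set D' = snd ` E'"
      using N.box_partition_imp_stanley_decomposition[OF E'(1)] by blast
    have "sdepth_decomp D \<le> sdepth_decomp D'"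
      using D' E' E by (intro sdepth_decomp_mono) auto
    also have "\<dots> \<le> sdepth n N"
      unfolding sdepth_def using D' by (intro SUP_upper) auto
    finally show ?thesis .
  qed
  then show ?thesis
    unfolding sdepth_def[of n "quot_module n J I"]
    by (intro SUP_least) (auto simp: M_def N_def)
qed

end
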